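(* Let $\|\cdot\|$ be a norm on $\mathbb{R}^2$ and let $V\subset \mathbb{R}^2$ be a finite set of vectors with $\|v\|=1$ for every $v\in V$, where $|V|$ is odd. Then there are signs $\varepsilon(v)\in\{-1,+1\}$ $(v\in V)$ such that $\left\|\sum_{v\in V}\varepsilon(v)v\right\|\le 1$. *)

theory Defs
  imports "HOL-Analysis.Analysis"
begin

(* The axioms are those of the class real_normed_vector, stated for a function instead of the
   overloaded constant norm, since the latter is the Euclidean norm on real ^ 'n.
   Nonnegativity follows from them. *)
definition is_norm :: "('a::real_vector \<Rightarrow> real) \<Rightarrow> bool" where
  "is_norm N \<longleftrightarrow>
     (\<forall>x. N x = 0 \<longleftrightarrow> x = 0) \<and>
     (\<forall>x y. N (x + y) \<le> N x + N y) \<and>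
     (\<forall>c x. N (c *\<^sub>R x) = \<bar>c\<bar> * N x)"

lemma is_norm_nonneg:
  assumes "is_norm N"
  shows "0 \<le> N x"
proof -
  have "N (x + (-1) *\<^sub>R x) \<le> N x + N ((-1) *\<^sub>R x)"
    using assms unfolding is_norm_def by blast
  moreover have "N ((-1) *\<^sub>R x) = \<bar>-1\<bar> * N x" and "N 0 = 0"
    using assms unfolding is_norm_def by blast+
  ultimately show ?thesis by simp
qed

lemma is_norm_norm: "is_norm (norm :: 'a::real_normed_vector \<Rightarrow> real)"
  by (simp add: is_norm_def norm_triangle_ineq)

end

(* Up to antipodal pairs, which cancel, replace the vectors by v_1, ..., v_n in angular order inside
   a half-plane. Their alternating sum w works. By duality it suffices to bound f w for a linear
   functional f of dual norm at most 1. Passing from v_1, ..., v_n to v_2, ..., v_n, -v_1 only changes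
   the sign of w because n is odd, so f can be assumed to be maximal at v_1 among all +-v_i. Then
   convexity of the unit ball makes f decreasing along the sequence, and an alternating sum of odd
   length of a decreasing sequence with values in [-1, 1] lies in [-1, 1]. *)

theory Submission
  imports Defs
begin

section \<open>Norms on a real vector space and duality\<close>

lemma is_norm_triangle: "is_norm N \<Longrightarrow> N (x + y) \<le> N x + N y"
  by (simp add: is_norm_def)

lemma is_norm_scaleR: "is_norm N \<Longrightarrow> N (c *\<^sub>R x) = \<bar>c\<bar> * N x"
  by (simp add: is_norm_def)

lemma is_norm_zero_iff: "is_norm N \<Longrightarrow> N x = 0 \<longleftrightarrow> x = 0"
  by (simp add: is_norm_def)

lemma is_norm_minus: "is_norm N \<Longrightarrow> N (- x) = N x"
  using is_norm_scaleR[of N "-1" x] by simp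

text \<open>A point outside the unit ball is separated from it by a hyperplane, whose normal,
  suitably scaled, violates \<open>dual\<close>.\<close>

lemma is_norm_le_one_by_duality:
  fixes N :: "'a::euclidean_space \<Rightarrow> real"
  assumes N: "is_norm N"
    and dual: "\<And>a. (\<And>x. N x \<le> 1 \<Longrightarrow> inner a x \<le> 1) \<Longrightarrow> inner a w \<le> 1"
  shows "N w \<le> 1"
proof (rule ccontr)
  assume "\<not> N w \<le> 1"
  \<comment> \<open>Any number strictly between 1 and \<open>N w\<close> serves: \<open>c\<close>
    stays outside the unit ball, and the factor \<open>s > 1\<close> makes up for the separation
    being weak only.\<close>
  define s where "s = (1 + N w) / 2"
  have s: "1 < s" "s < N w"
    using \<open>\<not> N w \<le> 1\<close> by (auto simp: s_def)
  define c where "c = (1 / s) *\<^sub>R w"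
  have "N c > 1"
    using s by (simp add: c_def is_norm_scaleR[OF N])
  have "convex {x. N x \<le> 1}"
  proof (rule convexI, safe)
    fix x y and u v :: real
    assume *: "N x \<le> 1" "N y \<le> 1" "0 \<le> u" "0 \<le> v" "u + v = 1"
    have "N (u *\<^sub>R x + v *\<^sub>R y) \<le> u * N x + v * N y"
      using is_norm_triangle[OF N, of "u *\<^sub>R x" "v *\<^sub>R y"] * by (simp add: is_norm_scaleR[OF N])
    also have "\<dots> \<le> u * 1 + v * 1"
      using * by (intro add_mono mult_left_mono) auto
    finally show "N (u *\<^sub>R x + v *\<^sub>R y) \<le> 1" using * by simp
  qed
  moreover have "convex {c}" "{x. N x \<le> 1} \<noteq> {}" "{c} \<noteq> {}" "{x. N x \<le> 1} \<inter> {c} = {}"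
    using \<open>N c > 1\<close> is_norm_zero_iff[OF N, of 0] by (auto intro!: exI[of _ 0])
  ultimately obtain a b where a: "a \<noteq> 0" and le: "\<And>x. N x \<le> 1 \<Longrightarrow> inner a x \<le> b"
    and ge: "inner a c \<ge> b"
    using separating_hyperplane_sets[of "{x. N x \<le> 1}" "{c}"] by auto
  have "N a > 0"
    using is_norm_nonneg[OF N, of a] is_norm_zero_iff[OF N, of a] a by linarith
  \<comment> \<open>The unit ball contains a positive multiple of \<open>a\<close>, which forces
    \<open>b > 0\<close>, so that \<open>a\<close> may be divided by \<open>b\<close>.\<close>
  have "inner a ((1 / N a) *\<^sub>R a) \<le> b"
    using \<open>N a > 0\<close> by (intro le) (simp add: is_norm_scaleR[OF N])
  moreover have "inner a ((1 / N a) *\<^sub>R a) > 0"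
    using \<open>N a > 0\<close> a by simp
  ultimately have "b > 0" by linarith
  have "inner ((1 / b) *\<^sub>R a) w \<le> 1"
    by (rule dual) (use le \<open>b > 0\<close> in \<open>simp add: field_simps\<close>)
  then have "inner a w \<le> b"
    using \<open>b > 0\<close> by (simp add: field_simps)
  moreover have "inner a w \<ge> s * b"
    using ge s by (simp add: c_def field_simps)
  ultimately have "s * b \<le> 1 * b"
    by simp
  then show False using s \<open>b > 0\<close> by simp
qed

section \<open>Alternating sums\<close>

primrec alt_sum :: "'a::ab_group_add list \<Rightarrow> 'a" where
  "alt_sum [] = 0"
| "alt_sum (x # xs) = x - alt_sum xs"

lemma alt_sum_append:
  "alt_sum (xs @ ys) = (if even (length xs) then alt_sum xs + alt_sum ys else alt_sum xs - alt_sum ys)"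
  by (induction xs) auto

lemma alt_sum_map_uminus: "alt_sum (map uminus xs) = - alt_sum xs"
  by (induction xs) auto

lemma inner_alt_sum: "inner a (alt_sum xs) = alt_sum (map (inner a) xs)"
  by (induction xs) (auto simp: inner_diff_right)

text \<open>Exactly one of \<open>xs\<close> and \<open>ys\<close> has odd length. The sum is
  unchanged if that is \<open>ys\<close> and changes sign if it is \<open>xs\<close>.\<close>

lemma alt_sum_rotate:
  assumes "odd (length (xs @ ys))"
  shows "alt_sum (ys @ map uminus xs) \<in> {alt_sum (xs @ ys), - alt_sum (xs @ ys)}"
  using assms by (auto simp: alt_sum_append alt_sum_map_uminus)

text \<open>The lists of odd length are the ones of interest; the two parities are proved together
  because each feeds the induction step of the other.\<close>

lemma alt_sum_decreasing_bounds:
  fixes x M :: real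
  assumes "sorted_wrt (\<ge>) (x # xs)" "\<forall>y\<in>set (x # xs). - M \<le> y"
  shows "(if even (length xs) then - M \<le> alt_sum (x # xs) \<and> alt_sum (x # xs) \<le> x
          else 0 \<le> alt_sum (x # xs) \<and> alt_sum (x # xs) \<le> x + M)"
  using assms
proof (induction xs arbitrary: x)
  case (Cons y ys)
  have "y \<le> x" using Cons.prems by simp
  with Cons.IH[of y] Cons.prems show ?case
    by (auto split: if_splits)
qed auto

text \<open>Translates back to the original vectors: the alternation and the replacement of
  \<open>v\<close> by \<open>s v\<close> both amount to a sign.\<close>

lemma alt_sum_signs:
  fixes s :: "'a::real_vector \<Rightarrow> 'a"
  assumes "distinct zs" "\<And>v. s v \<in> {v, - v}"
  shows "\<exists>\<epsilon>. (\<forall>v\<in>set zs. \<epsilon> v \<in> {-1, 1 :: real}) \<and>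
           alt_sum (map s zs) = (\<Sum>v\<in>set zs. \<epsilon> v *\<^sub>R v)"
  using assms(1)
proof (induction zs)
  case (Cons z zs)
  then obtain \<epsilon> where \<epsilon>: "\<forall>v\<in>set zs. \<epsilon> v \<in> {-1, 1 :: real}"
    "alt_sum (map s zs) = (\<Sum>v\<in>set zs. \<epsilon> v *\<^sub>R v)" by auto
  define \<delta> where "\<delta> = (\<lambda>v. if v = z then (if s z = z then 1 else - 1) else - \<epsilon> v)"
  have "(\<Sum>v\<in>set zs. \<delta> v *\<^sub>R v) = (\<Sum>v\<in>set zs. - (\<epsilon> v *\<^sub>R v))"
    using Cons.prems by (intro sum.cong) (auto simp: \<delta>_def)
  moreover have "\<delta> z *\<^sub>R z = s z"
    using assms(2)[of z] by (auto simp: \<delta>_def)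
  ultimately have "alt_sum (map s (z # zs)) = (\<Sum>v\<in>set (z # zs). \<delta> v *\<^sub>R v)"
    using Cons.prems \<epsilon>(2) by (simp add: sum_negf)
  moreover have "\<forall>v\<in>set (z # zs). \<delta> v \<in> {-1, 1}"
    using \<epsilon>(1) by (auto simp: \<delta>_def)
  ultimately show ?case by blast
qed auto

section \<open>Orientation in the plane and monotonicity along the unit sphere\<close>

text \<open>The determinant with columns \<open>u\<close> and \<open>v\<close>, positive when
  \<open>v\<close> is reached from \<open>u\<close> by a counterclockwise turn of less than
  pi.\<close>

definition cross2 :: "real ^ 2 \<Rightarrow> real ^ 2 \<Rightarrow> real" where
  "cross2 u v = u $ 1 * v $ 2 - u $ 2 * v $ 1"

lemma cross2_minus_right: "cross2 u (- v) = cross2 v u"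
  by (simp add: cross2_def algebra_simps)

text \<open>Cramer's rule for the coordinates of \<open>u\<close> with respect to \<open>p\<close>
  and \<open>v\<close>.\<close>

lemma cross2_plucker: "cross2 p v *\<^sub>R u = cross2 u v *\<^sub>R p + cross2 p u *\<^sub>R v"
  by (simp add: vec_eq_iff forall_2 cross2_def algebra_simps)

text \<open>Here \<open>u\<close> lies in the open cone spanned by \<open>p\<close> and
  \<open>v\<close>, say u = \<alpha> p + \<beta> v. Two triangle inequalities give |\<beta> - 1|
  \<le> \<alpha>, so \<alpha> times the value at \<open>p\<close> outweighs (\<beta> - 1) times the
  value at \<open>v\<close>.\<close>

lemma inner_decreasing_along_sphere:
  assumes N: "is_norm N" and unit: "N p = 1" "N u = 1" "N v = 1"
    and ord: "cross2 p u > 0" "cross2 u v > 0" "cross2 p v > 0"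
    and max: "\<bar>inner a v\<bar> \<le> inner a p"
  shows "inner a v \<le> inner a u"
proof -
  define \<alpha> \<beta> where "\<alpha> = cross2 u v / cross2 p v" and "\<beta> = cross2 p u / cross2 p v"
  have pos: "\<alpha> > 0" "\<beta> > 0" using ord by (auto simp: \<alpha>_def \<beta>_def)
  have "(1 / cross2 p v) *\<^sub>R (cross2 p v *\<^sub>R u)
      = (1 / cross2 p v) *\<^sub>R (cross2 u v *\<^sub>R p + cross2 p u *\<^sub>R v)"
    by (rule arg_cong[OF cross2_plucker])
  then have u: "u = \<alpha> *\<^sub>R p + \<beta> *\<^sub>R v"
    using ord by (simp add: \<alpha>_def \<beta>_def scaleR_add_right)
  have le1: "1 \<le> \<alpha> + \<beta>"
    using is_norm_triangle[OF N, of "\<alpha> *\<^sub>R p" "\<beta> *\<^sub>R v"] pos unit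
    by (simp add: is_norm_scaleR[OF N] flip: u)
  have "\<beta> *\<^sub>R v = u + (- \<alpha>) *\<^sub>R p" by (subst u) simp
  then have "N (\<beta> *\<^sub>R v) \<le> N u + N ((- \<alpha>) *\<^sub>R p)"
    using is_norm_triangle[OF N, of u "(- \<alpha>) *\<^sub>R p"] by simp
  then have le2: "\<beta> \<le> 1 + \<alpha>"
    using pos unit by (simp only: is_norm_scaleR[OF N])
  have "\<bar>\<beta> - 1\<bar> * \<bar>inner a v\<bar> \<le> \<alpha> * inner a p"
    using le1 le2 pos max by (intro mult_mono) auto
  then have "- ((\<beta> - 1) * inner a v) \<le> \<alpha> * inner a p"
    by (metis abs_ge_minus_self abs_mult order_trans)
  moreover have "inner a u = \<alpha> * inner a p + \<beta> * inner a v"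
    by (subst u) (simp add: inner_add_right)
  ultimately show ?thesis by (simp add: algebra_simps)
qed

lemma inner_alt_sum_le:
  assumes N: "is_norm N" and unit: "\<forall>v\<in>set xs. N v = 1"
    and ord: "sorted_wrt (\<lambda>u v. cross2 u v > 0) xs" and odd: "odd (length xs)"
    and dual: "\<And>x. N x \<le> 1 \<Longrightarrow> inner a x \<le> 1"
  shows "inner a (alt_sum xs) \<le> 1"
proof -
  have "xs \<noteq> []" using odd by auto
  then have "Max ((\<lambda>v. \<bar>inner a v\<bar>) ` set xs) \<in> (\<lambda>v. \<bar>inner a v\<bar>) ` set xs"
    by (intro Max_in) auto
  then obtain p where p: "p \<in> set xs" "Max ((\<lambda>v. \<bar>inner a v\<bar>) ` set xs) = \<bar>inner a p\<bar>"
    by auto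
  have max: "\<bar>inner a v\<bar> \<le> \<bar>inner a p\<bar>" if "v \<in> set xs" for v
    unfolding p(2)[symmetric] using that by (intro Max_ge) auto
  obtain ys zs where xs: "xs = ys @ p # zs"
    using p(1) by (meson split_list)
  \<comment> \<open>The list is restarted at \<open>p\<close>, and the vectors passed over reappear
    negated at the end; \<open>cross2_minus_right\<close> keeps all pairs positively
    oriented.\<close>
  define rs where "rs = zs @ map uminus ys"
  \<comment> \<open>The sign makes \<open>inner b p\<close> itself, not just its absolute value, the
    maximum.\<close>
  define b where "b = (if inner a p \<ge> 0 then a else - a)"
  have b: "inner b p = \<bar>inner a p\<bar>" "\<And>x. \<bar>inner b x\<bar> = \<bar>inner a x\<bar>"
    by (auto simp: b_def)
  have ord': "sorted_wrt (\<lambda>u v. cross2 u v > 0) (p # rs)"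
    using ord unfolding xs rs_def
    by (auto simp: sorted_wrt_append sorted_wrt_map cross2_minus_right)
  have unit': "\<forall>v\<in>set (p # rs). N v = 1"
    using unit unfolding xs rs_def by (auto simp: is_norm_minus[OF N])
  have max': "\<forall>v\<in>set (p # rs). \<bar>inner b v\<bar> \<le> inner b p"
    using max unfolding b xs rs_def by auto
  have "inner b v \<le> inner b u" if "cross2 u v > 0" "u \<in> set rs" "v \<in> set rs" for u v
    using that ord' unit' max' by (intro inner_decreasing_along_sphere[OF N, of p]) auto
  then have "sorted_wrt (\<lambda>u v. inner b v \<le> inner b u) rs"
    using ord' by (auto intro: sorted_wrt_mono_rel[where P = "\<lambda>u v. cross2 u v > 0"])
  then have "sorted_wrt (\<ge>) (map (inner b) (p # rs))"
    using max' by (auto simp: sorted_wrt_map abs_le_iff)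
  moreover have "\<forall>y\<in>set (map (inner b) (p # rs)). - inner b p \<le> y"
    using max' by (auto simp: abs_le_iff)
  moreover have "even (length rs)"
    using odd by (simp add: xs rs_def)
  \<comment> \<open>The odd-length bound with the first entry and \<open>M\<close> both equal to
    \<open>inner b p\<close>.\<close>
  ultimately have "\<bar>inner b (alt_sum (p # rs))\<bar> \<le> inner b p"
    using alt_sum_decreasing_bounds[of "inner b p" "map (inner b) rs" "inner b p"]
    by (simp add: inner_alt_sum abs_le_iff inner_diff_right)
  then have "\<bar>inner a (alt_sum (p # rs))\<bar> \<le> \<bar>inner a p\<bar>"
    by (simp only: b)
  moreover have "alt_sum (p # rs) \<in> {alt_sum xs, - alt_sum xs}"
    using alt_sum_rotate[of ys "p # zs"] odd by (simp add: xs rs_def)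
  ultimately have "\<bar>inner a (alt_sum xs)\<bar> \<le> \<bar>inner a p\<bar>"
    by auto
  also have "\<bar>inner a p\<bar> \<le> 1"
    using dual[of p] dual[of "- p"] unit p(1) by (simp add: is_norm_minus[OF N])
  finally show ?thesis by simp
qed

section \<open>Angular order in a half-plane\<close>

text \<open>Only one ray of the boundary line is included, so that exactly one of \<open>v\<close>
  and \<open>- v\<close> belongs to the set when \<open>v\<close> is nonzero.\<close>

definition half_plane :: "(real ^ 2) set" where
  "half_plane = {v. v $ 1 > 0 \<or> v $ 1 = 0 \<and> v $ 2 > 0}"

text \<open>A linearly ordered sort key for the angle on \<open>half_plane\<close>; the vertical ray
  comes last, with value infinity.\<close>

definition slope :: "real ^ 2 \<Rightarrow> ereal" where
  "slope v = (if v $ 1 = 0 then \<infinity> else ereal (v $ 2 / v $ 1))"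

lemma slope_less_imp_cross2_pos:
  assumes "u \<in> half_plane" "v \<in> half_plane" "slope u < slope v"
  shows "cross2 u v > 0"
  using assms by (auto simp: half_plane_def slope_def cross2_def field_simps split: if_splits)

lemma half_plane_minus: "v \<noteq> 0 \<Longrightarrow> v \<notin> half_plane \<Longrightarrow> - v \<in> half_plane"
  by (auto simp: half_plane_def vec_eq_iff forall_2)

text \<open>Equal slopes in \<open>half_plane\<close> mean proportionality with a positive factor,
  and equal norms make that factor 1.\<close>

lemma slope_eq_imp_eq:
  assumes N: "is_norm N" and unit: "N u = 1" "N v = 1"
    and uv: "u \<in> half_plane" "v \<in> half_plane" and eq: "slope u = slope v"
  shows "u = v"
proof -
  have "\<exists>c>0. v = c *\<^sub>R u"
  proof (cases "u $ 1 = 0")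
    case True
    then have "v $ 1 = 0" using eq by (auto simp: slope_def split: if_splits)
    then show ?thesis using True uv
      by (intro exI[of _ "v $ 2 / u $ 2"]) (auto simp: half_plane_def vec_eq_iff forall_2)
  next
    case False
    then have "v $ 1 \<noteq> 0" "u $ 2 / u $ 1 = v $ 2 / v $ 1"
      using eq by (auto simp: slope_def split: if_splits)
    then show ?thesis using False uv
      by (intro exI[of _ "v $ 1 / u $ 1"]) (auto simp: half_plane_def vec_eq_iff forall_2 field_simps)
  qed
  then obtain c where "c > 0" "v = c *\<^sub>R u" by blast
  with unit show ?thesis by (simp add: is_norm_scaleR[OF N])
qed

section \<open>Choice of signs and removal of antipodal pairs\<close>

lemma signs_of_antipodal_free:
  assumes N: "is_norm N" and fin: "finite V" and unit: "\<And>v. v \<in> V \<Longrightarrow> N v = 1"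
    and odd: "odd (card V)" and free: "\<And>v. v \<in> V \<Longrightarrow> - v \<notin> V"
  shows "\<exists>\<epsilon> :: real ^ 2 \<Rightarrow> real. (\<forall>v\<in>V. \<epsilon> v \<in> {-1, 1}) \<and> N (\<Sum>v\<in>V. \<epsilon> v *\<^sub>R v) \<le> 1"
proof -
  define s :: "real ^ 2 \<Rightarrow> real ^ 2" where "s v = (if v \<in> half_plane then v else - v)" for v
  have s: "s v \<in> {v, - v}" for v by (simp add: s_def)
  have nz: "v \<noteq> 0" if "v \<in> V" for v
    using unit[OF that] is_norm_zero_iff[OF N, of v] by auto
  have s_half: "s v \<in> half_plane" if "v \<in> V" for v
    using half_plane_minus[OF nz[OF that]] by (simp add: s_def)
  have s_unit: "N (s v) = 1" if "v \<in> V" for v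
    using unit[OF that] by (simp add: s_def is_norm_minus[OF N])
  \<comment> \<open>Equal slopes give \<open>s u = s v\<close>, hence u = v or u = -v, and
    \<open>free\<close> excludes the latter. The sorting below is therefore strict.\<close>
  have inj: "inj_on (\<lambda>v. slope (s v)) V"
  proof (rule inj_onI)
    fix u v assume uv: "u \<in> V" "v \<in> V" "slope (s u) = slope (s v)"
    then have "s u = s v"
      using slope_eq_imp_eq[OF N] s_unit s_half by blast
    then show "u = v"
      using free uv by (auto simp: s_def split: if_splits)
  qed
  obtain ws where ws: "set ws = V" "distinct ws"
    using finite_distinct_list[OF fin] by blast
  define zs where "zs = sort_key (\<lambda>v. slope (s v)) ws"
  have zs: "set zs = V" "distinct zs" using ws by (auto simp: zs_def)
  have "sorted_wrt (<) (map (\<lambda>v. slope (s v)) zs)"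
    using inj zs by (auto simp: strict_sorted_iff distinct_map) (simp add: zs_def)
  then have "sorted_wrt (\<lambda>u v. slope (s u) < slope (s v)) zs"
    by (simp add: sorted_wrt_map)
  then have "sorted_wrt (\<lambda>u v. cross2 (s u) (s v) > 0) zs"
    by (rule sorted_wrt_mono_rel[rotated]) (use zs s_half slope_less_imp_cross2_pos in blast)
  then have ord: "sorted_wrt (\<lambda>u v. cross2 u v > 0) (map s zs)"
    by (simp add: sorted_wrt_map)
  have "odd (length (map s zs))"
    using odd zs by (metis distinct_card length_map)
  then have "N (alt_sum (map s zs)) \<le> 1"
    using zs s_unit by (intro is_norm_le_one_by_duality[OF N] inner_alt_sum_le[OF N _ ord]) auto
  then show ?thesis
    using alt_sum_signs[of zs s, OF zs(2) s] zs(1) by metis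
qed

theorem theorem1:
  fixes N :: "real ^ 2 \<Rightarrow> real" and V :: "(real ^ 2) set"
  assumes "is_norm N"
    and "finite V"
    and "\<And>v. v \<in> V \<Longrightarrow> N v = 1"
    and "odd (card V)"
  shows "\<exists>\<epsilon> :: real ^ 2 \<Rightarrow> real. (\<forall>v\<in>V. \<epsilon> v \<in> {-1, 1}) \<and> N (\<Sum>v\<in>V. \<epsilon> v *\<^sub>R v) \<le> 1"
  using assms(2-4)
proof (induction V rule: finite_psubset_induct)
  case (psubset V)
  show ?case
  proof (cases "\<exists>v\<in>V. - v \<in> V")
    case False
    with psubset show ?thesis
      by (intro signs_of_antipodal_free[OF assms(1)]) auto
  next
    case True
    then obtain v where v: "v \<in> V" "- v \<in> V" by blast
    have "v \<noteq> 0"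
      using psubset.prems(1)[OF v(1)] is_norm_zero_iff[OF assms(1), of v] by auto
    \<comment> \<open>Two distinct vectors are removed, so the cardinality stays odd.\<close>
    then have "v \<noteq> - v" by (auto simp: vec_eq_iff forall_2)
    define W where "W = V - {v, - v}"
    have V: "V = insert v (insert (- v) W)" "v \<notin> W" "- v \<notin> W" "finite W"
      using v psubset.hyps by (auto simp: W_def)
    have "odd (card W)"
      using psubset.prems(2) V(2-4) \<open>v \<noteq> - v\<close> by (simp add: V(1))
    moreover have "W \<subset> V" using v by (auto simp: W_def)
    ultimately obtain \<epsilon> :: "real ^ 2 \<Rightarrow> real"
      where \<epsilon>: "\<forall>u\<in>W. \<epsilon> u \<in> {-1, 1}" "N (\<Sum>u\<in>W. \<epsilon> u *\<^sub>R u) \<le> 1"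
      using psubset.IH[of W] psubset.prems(1) by blast
    \<comment> \<open>The default 1 gives \<open>v\<close> and \<open>- v\<close> the same sign, so
      their contributions cancel.\<close>
    define \<delta> where "\<delta> u = (if u \<in> W then \<epsilon> u else 1)" for u
    have "(\<Sum>u\<in>V. \<delta> u *\<^sub>R u) = (\<Sum>u\<in>W. \<delta> u *\<^sub>R u)"
      using V(2-4) \<open>v \<noteq> - v\<close> by (simp add: V(1)) (simp add: \<delta>_def)
    also have "\<dots> = (\<Sum>u\<in>W. \<epsilon> u *\<^sub>R u)"
      by (simp add: \<delta>_def)
    finally have "N (\<Sum>u\<in>V. \<delta> u *\<^sub>R u) \<le> 1"
      using \<epsilon>(2) by simp
    moreover have "\<forall>u\<in>V. \<delta> u \<in> {-1, 1}"
      using \<epsilon>(1) by (auto simp: \<delta>_def)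
    ultimately show ?thesis by blast
  qed
qed

end
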